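(* Let $\Phi:\mathbb R\to\mathbb R$ be convex, let $a>0$, $b\in\mathbb R$, and set $F(x):=\Phi(x)-ae^{2x}+bx$ for $x\in\mathbb R$. Then for every $c\in(0,\frac14]$ and every $x\in\mathbb R$, $$\int_{x-h_x}^{x+h_x}e^{F(u)}\,du\ \ge\ 2e^{-4ac^2}\,h_x\,e^{F(x)},\qquad h_x:=\min\left\{\tfrac14,\ c\,e^{-x}\right\}.$$ *)

theory Defs
  imports "HOL-Analysis.Analysis"
begin

definition F :: "(real \<Rightarrow> real) \<Rightarrow> real \<Rightarrow> real \<Rightarrow> real \<Rightarrow> real" where
  "F \<Phi> a b x = \<Phi> x - a * exp (2 * x) + b * x"

definition h :: "real \<Rightarrow> real \<Rightarrow> real" where
  "h c x = min (1/4) (c * exp (- x))"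

end

theory Submission
  imports Defs
begin

text \<open>Averaging the integrand with its reflection in \<open>x\<close> turns the integral bound into a pointwise
  one. By AM-GM, \<open>exp (F (x + t)) + exp (F (x - t))\<close> is at least twice the exponential of the mean of
  the exponents, in which the linear term cancels, the convex part is at least \<open>\<Phi> x\<close>, and the loss is
  \<open>a * exp (2 * x) * (cosh (2 * t) - 1) \<le> 4 * a * (t * exp x)\<^sup>2 \<le> 4 * a * c\<^sup>2\<close>.\<close>

text \<open>\<open>cosh\<close> is even, so \<open>s\<close> may be replaced by
  \<open>r = \<bar>s\<bar>\<close>. Averaging quadratic upper bounds for \<open>exp r\<close> and
  \<open>exp (- r)\<close> then cancels the linear terms.\<close>

lemma cosh_le_one_plus_square:
  fixes s :: real
  assumes "\<bar>s\<bar> \<le> 1"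
  shows "cosh s \<le> 1 + s\<^sup>2"
proof -
  define r where "r = \<bar>s\<bar>"
  have r: "0 \<le> r" "r \<le> 1" using assms by (auto simp: r_def)
  have "exp r \<le> 1 + r + r\<^sup>2" using r by (rule exp_bound)
  moreover have "exp (- r) \<le> 1 - r + r\<^sup>2"
  proof -
    \<comment> \<open>The factor \<open>1 + r\<close> of \<open>1 + r ^ 3\<close> is bounded by
      \<open>exp r\<close>; dividing by \<open>exp r\<close> leaves the bound on
      \<open>exp (- r)\<close>.\<close>
    have "1 \<le> 1 + r ^ 3" using r by simp
    also have "\<dots> = (1 + r) * (1 - r + r\<^sup>2)"
      by (simp add: algebra_simps power2_eq_square power3_eq_cube)
    also have "\<dots> \<le> exp r * (1 - r + r\<^sup>2)"
      using r by (intro mult_right_mono exp_ge_add_one_self) auto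
    finally show ?thesis by (simp add: exp_minus field_simps)
  qed
  ultimately have "cosh r \<le> 1 + r\<^sup>2" by (simp add: cosh_field_def)
  then show ?thesis by (simp add: r_def abs_if split: if_splits)
qed

text \<open>AM-GM, obtained by expanding the square of
  \<open>exp (p / 2) - exp (q / 2)\<close>.\<close>

lemma two_exp_mean_le:
  fixes p q :: real
  shows "2 * exp ((p + q) / 2) \<le> exp p + exp q"
proof -
  have "0 \<le> (exp (p / 2) - exp (q / 2))\<^sup>2" by simp
  then show ?thesis
    by (simp add: power2_diff add_divide_distrib exp_add flip: exp_double)
qed

text \<open>The reflection is the affine map with slope -1 that carries the interval onto itself;
  for \<open>r < 0\<close> the interval is empty.\<close>

lemma has_integral_reflect_about:
  fixes f :: "real \<Rightarrow> real"
  assumes "(f has_integral i) {x - r .. x + r}"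
  shows "((\<lambda>u. f (2 * x - u)) has_integral i) {x - r .. x + r}"
proof -
  have "(\<lambda>u. 2 * x - u) ` {x - r .. x + r} = {x - r .. x + r}"
    using image_affinity_atLeastAtMost[of "-1" "2 * x" "x - r" "x + r"]
    by (cases "r < 0") (auto simp: algebra_simps)
  then show ?thesis
    using has_integral_affinity[of f i "x - r" "x + r" "-1" "2 * x"] assms
    by (simp add: add.commute)
qed

lemma exp_F_symmetric_ge:
  assumes conv: "convex_on UNIV \<Phi>" and "a > 0" and t: "\<bar>t\<bar> \<le> h c x"
  shows "2 * exp (- 4 * a * c\<^sup>2) * exp (F \<Phi> a b x)
           \<le> exp (F \<Phi> a b (x + t)) + exp (F \<Phi> a b (x - t))"
proof -
  \<comment> \<open>The two branches of the minimum have separate uses: \<open>1/4\<close> keeps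
    \<open>2 * t\<close> where the quadratic bound on \<open>cosh\<close> is valid, and
    \<open>c * exp (- x)\<close> offsets the growth of \<open>exp (2 * x)\<close>.\<close>
  have t4: "\<bar>t\<bar> \<le> 1/4" and tc: "\<bar>t\<bar> \<le> c * exp (- x)"
    using t by (auto simp: h_def)
  have "\<bar>t\<bar> * exp x \<le> c" using tc by (simp add: exp_minus field_simps)
  then have "(\<bar>t\<bar> * exp x)\<^sup>2 \<le> c\<^sup>2" by (intro power_mono) auto
  then have "exp (2 * x) * t\<^sup>2 \<le> c\<^sup>2"
    by (simp only: power_mult_distrib power2_abs exp_double mult.commute[of "t\<^sup>2"])
  moreover have "cosh (2 * t) - 1 \<le> 4 * t\<^sup>2"
    using cosh_le_one_plus_square[of "2 * t"] t4 by (simp add: abs_mult)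
  then have "exp (2 * x) * (cosh (2 * t) - 1) \<le> exp (2 * x) * (4 * t\<^sup>2)"
    by (rule mult_left_mono) simp
  ultimately have "exp (2 * x) * (cosh (2 * t) - 1) \<le> 4 * c\<^sup>2"
    by linarith
  then have loss: "a * (exp (2 * x) * (cosh (2 * t) - 1)) \<le> a * (4 * c\<^sup>2)"
    using \<open>a > 0\<close> by (intro mult_left_mono) auto
  \<comment> \<open>Midpoint convexity: \<open>x\<close> is the mean of \<open>x + t\<close> and
    \<open>x - t\<close>.\<close>
  have "\<Phi> x \<le> (\<Phi> (x + t) + \<Phi> (x - t)) / 2"
    using convex_onD[OF conv, of "1/2" "x + t" "x - t"]
    by (simp add: field_simps)
  moreover have "exp (2 * (x + t)) + exp (2 * (x - t)) = 2 * (exp (2 * x) * cosh (2 * t))"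
  proof -
    have "exp (2 * (x + t)) = exp (2 * x) * exp (2 * t)"
      by (simp add: distrib_left flip: exp_add)
    moreover have "exp (2 * (x - t)) = exp (2 * x) * exp (- (2 * t))"
      by (simp add: right_diff_distrib flip: exp_add)
    ultimately show ?thesis by (simp add: cosh_field_def distrib_left)
  qed
  then have "a * exp (2 * (x + t)) + a * exp (2 * (x - t)) = 2 * (a * (exp (2 * x) * cosh (2 * t)))"
    by (simp only: mult.left_commute flip: distrib_left)
  then have "(F \<Phi> a b (x + t) + F \<Phi> a b (x - t)) / 2
      = (\<Phi> (x + t) + \<Phi> (x - t)) / 2 - a * (exp (2 * x) * cosh (2 * t)) + b * x"
    by (simp add: F_def field_simps)
  \<comment> \<open>Once \<open>loss\<close> is distributed, the products with
    \<open>exp (2 * x)\<close> are common atoms and the claim is linear in them.\<close>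
  ultimately have "- 4 * a * c\<^sup>2 + F \<Phi> a b x \<le> (F \<Phi> a b (x + t) + F \<Phi> a b (x - t)) / 2"
    using loss unfolding F_def[of \<Phi> a b x] right_diff_distrib by linarith
  then have "2 * exp (- 4 * a * c\<^sup>2 + F \<Phi> a b x)
      \<le> 2 * exp ((F \<Phi> a b (x + t) + F \<Phi> a b (x - t)) / 2)"
    by (simp only: exp_le_cancel_iff mult_le_cancel_left_pos zero_less_numeral)
  also have "\<dots> \<le> exp (F \<Phi> a b (x + t)) + exp (F \<Phi> a b (x - t))"
    by (rule two_exp_mean_le)
  finally show ?thesis by (simp only: exp_add mult.assoc)
qed

theorem lemma2p1:
  fixes \<Phi> :: "real \<Rightarrow> real" and a b c x :: real
  assumes "convex_on UNIV \<Phi>"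
    and "a > 0"
    and "0 < c" and "c \<le> 1/4"
  shows "integral {x - h c x .. x + h c x} (\<lambda>u. exp (F \<Phi> a b u))
           \<ge> 2 * exp (- 4 * a * c\<^sup>2) * h c x * exp (F \<Phi> a b x)"
proof -
  define r where "r = h c x"
  define f where "f = (\<lambda>u. exp (F \<Phi> a b u))"
  define K where "K = 2 * exp (- 4 * a * c\<^sup>2) * exp (F \<Phi> a b x)"
  have "r \<ge> 0" using assms by (simp add: r_def h_def)
  have "continuous_on UNIV \<Phi>" by (rule convex_on_continuous[OF open_UNIV assms(1)])
  then have "continuous_on {x - r .. x + r} \<Phi>" by (rule continuous_on_subset) simp
  then have "continuous_on {x - r .. x + r} f"
    unfolding f_def F_def by (intro continuous_intros)
  then have I: "(f has_integral integral {x - r .. x + r} f) {x - r .. x + r}"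
    by (intro integrable_integral integrable_continuous_interval)
  \<comment> \<open>The interval has length \<open>2 * r\<close>, and \<open>f\<close> and its
    reflection have the same integral, so the factor 2 cancels.\<close>
  have "(2 * r) * K \<le> 2 * integral {x - r .. x + r} f"
  proof (rule has_integral_le)
    show "((\<lambda>u. K) has_integral (2 * r) * K) {x - r .. x + r}"
      using has_integral_const_real[of K "x - r" "x + r"] \<open>r \<ge> 0\<close> by simp
    show "((\<lambda>u. f u + f (2 * x - u)) has_integral 2 * integral {x - r .. x + r} f) {x - r .. x + r}"
      using has_integral_add[OF I has_integral_reflect_about[OF I]] by simp
    \<comment> \<open>With \<open>t = u - x\<close>, the points \<open>x + t\<close> and
      \<open>x - t\<close> are \<open>u\<close> and \<open>2 * x - u\<close>.\<close>
    show "K \<le> f u + f (2 * x - u)" if "u \<in> {x - r .. x + r}" for u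
      using exp_F_symmetric_ge[OF assms(1,2), of "u - x" c x b] that
      by (auto simp: K_def f_def r_def abs_le_iff algebra_simps)
  qed
  then have "r * K \<le> integral {x - r .. x + r} f" by simp
  moreover have "r * K = 2 * exp (- 4 * a * c\<^sup>2) * h c x * exp (F \<Phi> a b x)"
    unfolding K_def r_def by (simp only: mult_ac)
  ultimately show ?thesis by (simp only: r_def f_def)
qed

end
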